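(* Let $n\ge 4$ and let $z_1,\dots,z_n\in\mathbb{C}$ be not all zero. The configuration $z_1,\dots,z_n$ is optimal for $\mu_{n,2}^{\max}$ if and only if, up to a permutation of $z_1,\dots,z_n$, $$z_1=\cdots=z_{n-2},\qquad |z_1|=\frac{1}{n+1}\sum_{k=1}^n|z_k|,\qquad z_1+z_{n-1}+z_n=0.$$
   Context: Define $$\mu_{n,2}^{\max}:=\min\Big\{\max_{1\le k<l\le n}\big(|w_k|+|w_l|+|w_k+w_l|\big) : w_1,\dots,w_n\in\mathbb{C},\ \sum_{k=1}^n|w_k|=1\Big\}.$$ A configuration $z_1,\dots,z_n\in\mathbb{C}$, not all zero, is called optimal for $\mu_{n,2}^{\max}$ if, after rescaling by a positive factor so that $\sum_k|z_k|=1$, it attains this minimum; equivalently, if $\max_{1\le k<l\le n}(|z_k|+|z_l|+|z_k+z_l|)=\mu_{n,2}^{\max}\sum_{k=1}^n|z_k|$. *)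

theory Defs
  imports Complex_Main "HOL-Combinatorics.Permutations"
begin

text \<open>A configuration \<open>z\<^sub>1, \<dots>, z\<^sub>n\<close> is a function on \<open>nat\<close> of which only the values at \<open>1, \<dots>, n\<close> matter.\<close>

definition pair_max :: "nat \<Rightarrow> (nat \<Rightarrow> complex) \<Rightarrow> real" where
  "pair_max n w =
     Max {cmod (w k) + cmod (w l) + cmod (w k + w l) | k l. 1 \<le> k \<and> k < l \<and> l \<le> n}"

text \<open>
  For \<open>n \<ge> 2\<close> the infimum is over a nonempty set of nonnegative reals, and it is attained: the
  normalised configurations form a compact set on which \<open>pair_max n\<close> is continuous. It is therefore
  the minimum.
\<close>

definition mu_max :: "nat \<Rightarrow> real" where
  "mu_max n = Inf {pair_max n w | w. (\<Sum>k=1..n. cmod (w k)) = 1}"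

definition optimal :: "nat \<Rightarrow> (nat \<Rightarrow> complex) \<Rightarrow> bool" where
  "optimal n z \<longleftrightarrow>
     (\<exists>c::real. c > 0 \<and> (\<Sum>k=1..n. cmod (complex_of_real c * z k)) = 1 \<and>
        pair_max n (\<lambda>k. complex_of_real c * z k) = mu_max n)"

end

theory Submission
  imports Defs
begin

text \<open>
  Rescale so that the norms sum to \<open>n + 1\<close>, and call \<open>s\<^sub>k = |z\<^sub>k| - 1\<close> the excess of \<open>z\<^sub>k\<close>. The claim is
  then that \<open>|z\<^sub>k| + |z\<^sub>l| + |z\<^sub>k + z\<^sub>l| \<le> 4\<close> for all pairs is possible only for the listed
  configurations. In these every pair attains the value 4, so the minimum is \<open>4 / (n + 1)\<close>.

  Squaring turns the bound on a pair into \<open>4 (s\<^sub>k + s\<^sub>l) \<le> |z\<^sub>k| |z\<^sub>l| - z\<^sub>k \<bullet> z\<^sub>l\<close>. Summing this over a triple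
  with total excess \<open>S\<close> gives \<open>|z\<^sub>i + z\<^sub>j + z\<^sub>k|\<^sup>2 \<le> (1 - S) (9 - S)\<close>, so \<open>S \<le> 1\<close>, and \<open>S = 1\<close> forces
  the three vectors to sum to zero (\<open>perimeter_triple\<close>).

  Suppose that two vectors have \<open>s\<^sub>i + s\<^sub>j \<ge> 1\<close>. Each of the remaining \<open>n - 2 \<ge> 2\<close> vectors has excess at most
  \<open>1 - s\<^sub>i - s\<^sub>j \<le> 0\<close>, so a total excess of 1 is reached only if \<open>s\<^sub>i + s\<^sub>j = 1\<close> and all other
  excesses vanish. Then every triple through \<open>i\<close> and \<open>j\<close> is extremal, so all other vectors
  equal \<open>- (z\<^sub>i + z\<^sub>j)\<close>. This is the asserted structure.

  Otherwise all pairs have \<open>s\<^sub>i + s\<^sub>j < 1\<close>, and the total excess is less than 1. This is clear if at most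
  two excesses are positive. The remaining case is \<open>excess_sum_less\<close>, which rests on the planarity of
  the configuration. For excesses in \<open>[0, 1]\<close> the pair bound says that the half angle
  between the two vectors is at least \<open>arccos (c(s) c(t))\<close> with \<open>c(s) = \<surd>((1 - s) / (1 + s))\<close>. Going once
  round the origin in angular order, these lower bounds add up to at most \<open>\<pi>\<close>. Two neighbours with excesses
  \<open>s\<close> and \<open>t\<close> can be replaced by one vector with excess \<open>s + t\<close> without increasing this cyclic sum
  (\<open>sep_merge\<close>); it strictly decreases if \<open>s, t > 0\<close> and \<open>s + t < 1\<close>. Repeated merging ends with three
  excesses, for which the cyclic condition is precisely that their sum is at most 1 (\<open>sep_triple\<close>).
\<close>

section \<open>The separation forced by two excesses\<close>

text \<open>
  With \<open>s = r - 1\<close> one has \<open>(tilt s)\<^sup>2 = 2 / r - 1\<close>, the quantity in which the pair bound factorises: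
  for two vectors of norms \<open>r\<close>, \<open>q\<close> at angle \<open>\<phi>\<close> it reads \<open>cos\<^sup>2 (\<phi> / 2) \<le> (2 / r - 1) (2 / q - 1)\<close>.
\<close>

definition tilt :: "real \<Rightarrow> real" where
  "tilt s = sqrt ((1 - s) / (1 + s))"

text \<open>The least half angle between two vectors of excesses \<open>s\<close> and \<open>t\<close> that satisfy the pair bound.\<close>

definition sep :: "real \<Rightarrow> real \<Rightarrow> real" where
  "sep s t = arccos (tilt s * tilt t)"

lemma tilt_bounds:
  assumes "0 \<le> s" "s \<le> 1"
  shows "0 \<le> tilt s" "tilt s \<le> 1"
  using assms by (auto simp: tilt_def)

lemma tilt_square:
  assumes "0 \<le> s" "s \<le> 1"
  shows "(tilt s)\<^sup>2 = (1 - s) / (1 + s)"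
  using assms by (simp add: tilt_def)

lemma tilt_antimono:
  assumes "0 \<le> s" "s \<le> t" "t \<le> 1"
  shows "tilt t \<le> tilt s"
  using assms by (auto simp: tilt_def field_simps)

lemma arccos_mult_bounds:
  assumes "a \<in> {0..1}" "b \<in> {0..1::real}"
  shows "0 \<le> arccos (a * b)" "arccos (a * b) \<le> pi / 2"
    "cos (arccos (a * b)) = a * b" "sin (arccos (a * b)) = sqrt (1 - (a * b)\<^sup>2)"
proof -
  have "0 \<le> a * b" "a * b \<le> 1" using assms by (auto intro: mult_le_one)
  then show "0 \<le> arccos (a * b)" "arccos (a * b) \<le> pi / 2"
    "cos (arccos (a * b)) = a * b" "sin (arccos (a * b)) = sqrt (1 - (a * b)\<^sup>2)"
    using arccos_le_pi2[of "a * b"] by (auto intro: arccos_lbound simp: sin_arccos)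
qed

text \<open>The addition formula gives \<open>cos (A + B) \<le> cos A cos B = a b\<^sup>2 c \<le> a c\<close> for the two summands.\<close>

lemma arccos_mult_triangle:
  assumes "a \<in> {0..1}" "b \<in> {0..1}" "c \<in> {0..1::real}"
  shows "arccos (a * c) \<le> arccos (a * b) + arccos (b * c)"
proof -
  note ab = arccos_mult_bounds[OF assms(1,2)] and bc = arccos_mult_bounds[OF assms(2,3)]
    and ac = arccos_mult_bounds[OF assms(1,3)]
  have "cos (arccos (a * b) + arccos (b * c)) \<le> a * b * (b * c)"
    using sin_ge_zero[of "arccos (a * b)"] sin_ge_zero[of "arccos (b * c)"] ab bc
    by (simp add: cos_add)
  also have "\<dots> = (a * c) * (b * b)" by simp
  also have "\<dots> \<le> (a * c) * 1"
    using assms by (intro mult_left_mono) (auto intro: mult_le_one)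
  finally have "cos (arccos (a * b) + arccos (b * c)) \<le> cos (arccos (a * c))"
    using ac by simp
  then show ?thesis
    using ab bc ac by (subst (asm) cos_mono_le_eq) auto
qed

text \<open>
  Increasing the factor \<open>k\<close> widens the gap between the two arc cosines, so that \<open>k = 1\<close> is the worst case.
  This reduces the effect of a merge on any neighbour to its effect on a neighbour of excess 0, whose tilt is 1.
\<close>

lemma arccos_mult_shift:
  assumes "k \<in> {0..1}" "0 \<le> q" "q \<le> x" "x \<le> (1::real)"
  shows "arccos (k * q) - arccos (k * x) \<le> arccos q - arccos x"
proof -
  have q: "q \<in> {0..1}" and x: "x \<in> {0..1}" and one: "(1::real) \<in> {0..1}" using assms by auto
  note kq = arccos_mult_bounds[OF assms(1) q] and kx = arccos_mult_bounds[OF assms(1) x]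
  note q1 = arccos_mult_bounds[OF one q, simplified] and x1 = arccos_mult_bounds[OF one x, simplified]
  have sq: "y\<^sup>2 \<le> 1" if "y \<in> {0..1}" for y :: real using that by (simp add: power_le_one)
  define X where "X = sqrt (1 - x\<^sup>2)"
  define Q where "Q = sqrt (1 - q\<^sup>2)"
  have X: "X \<ge> 0" "X\<^sup>2 = 1 - x\<^sup>2" and Q: "Q \<ge> 0" "Q\<^sup>2 = 1 - q\<^sup>2"
    using sq[OF x] sq[OF q] by (simp_all add: X_def Q_def)
  define A where "A = 1 - (k * x)\<^sup>2"
  define B where "B = 1 - (k * q)\<^sup>2"
  have K: "1 - k\<^sup>2 \<ge> 0" using sq[OF assms(1)] by simp
  \<comment> \<open>Cauchy--Schwarz for \<open>(X, \<surd>(1 - k\<^sup>2) x)\<close> and \<open>(Q, \<surd>(1 - k\<^sup>2) q)\<close>, vectors of squared length \<open>A\<close> and \<open>B\<close>,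
     with the defect written out.\<close>
  have AB: "A * B - (X * Q + (1 - k\<^sup>2) * x * q)\<^sup>2 = (1 - k\<^sup>2) * (X * q - Q * x)\<^sup>2"
  proof -
    have "A = X\<^sup>2 + (1 - k\<^sup>2) * x\<^sup>2" and "B = Q\<^sup>2 + (1 - k\<^sup>2) * q\<^sup>2"
      using X Q by (simp_all add: A_def B_def algebra_simps)
    then show ?thesis by algebra
  qed
  have "(X * Q + (1 - k\<^sup>2) * x * q)\<^sup>2 \<le> A * B" using AB mult_nonneg_nonneg[OF K zero_le_power2, of "X * q - Q * x"] by linarith
  then have "X * Q + (1 - k\<^sup>2) * x * q \<le> sqrt (A * B)" by (rule real_le_rsqrt)
  then have "x * q + X * Q \<le> (k * x) * (k * q) + sqrt A * sqrt B"
    by (simp add: real_sqrt_mult algebra_simps power2_eq_square)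
  then have "cos (arccos q - arccos x) \<le> cos (arccos (k * q) - arccos (k * x))"
    using kq kx q1 x1 by (simp add: cos_diff X_def Q_def A_def B_def mult.commute)
  moreover have "arccos x \<le> arccos q" using assms by (intro arccos_le_arccos) auto
  moreover have "arccos (k * x) \<le> arccos (k * q)"
  proof (rule arccos_le_arccos)
    have "0 \<le> k * q" using assms by simp
    then show "- 1 \<le> k * q" by linarith
  qed (use assms in \<open>auto intro: mult_left_mono mult_le_one\<close>)
  ultimately show ?thesis using kq kx q1 x1 by (subst (asm) cos_mono_le_eq) auto
qed

text \<open>
  The merging inequality in the worst case where both neighbours have excess 0. All angles are reduced to
  \<open>g = x y\<close> and \<open>h = \<surd>(1 - x\<^sup>2) \<surd>(1 - y\<^sup>2)\<close> for the tilts \<open>x\<close>, \<open>y\<close> of \<open>s\<close>, \<open>t\<close>. Unless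
  the right-hand side exceeds \<open>\<pi>\<close>, it remains to compare cosines, and \<open>s + t \<le> 1\<close> enters
  exactly as \<open>h \<le> 2 g\<close>.
\<close>

lemma arccos_tilt_add:
  assumes "0 \<le> s" "0 \<le> t" "s + t \<le> 1"
  shows "2 * arccos (tilt (s + t)) \<le> arccos (tilt s) + arccos (tilt t) + sep s t"
    and "\<lbrakk>0 < s; 0 < t; s + t < 1\<rbrakk> \<Longrightarrow>
      2 * arccos (tilt (s + t)) < arccos (tilt s) + arccos (tilt t) + sep s t"
proof -
  define x where "x = tilt s"
  define y where "y = tilt t"
  define q where "q = tilt (s + t)"
  have s: "0 \<le> s" "s \<le> 1" and t: "0 \<le> t" "t \<le> 1" and st: "0 \<le> s + t" "s + t \<le> 1"
    using assms by auto
  have x: "x \<in> {0..1}" and y: "y \<in> {0..1}" and q: "q \<in> {0..1}"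
    using tilt_bounds[OF s] tilt_bounds[OF t] tilt_bounds[OF st] by (auto simp: x_def y_def q_def)
  have one: "(1::real) \<in> {0..1}" by auto
  note ax = arccos_mult_bounds[OF one x, simplified] and ay = arccos_mult_bounds[OF one y, simplified]
    and aq = arccos_mult_bounds[OF one q, simplified] and axy = arccos_mult_bounds[OF x y]
  have x2: "x\<^sup>2 = (1 - s) / (1 + s)" and y2: "y\<^sup>2 = (1 - t) / (1 + t)"
    and q2: "q\<^sup>2 = (1 - (s + t)) / (1 + (s + t))"
    using tilt_square[OF s] tilt_square[OF t] tilt_square[OF st] by (auto simp: x_def y_def q_def)
  define X where "X = sqrt (1 - x\<^sup>2)"
  define Y where "Y = sqrt (1 - y\<^sup>2)"
  define W where "W = sqrt (1 - (x * y)\<^sup>2)"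
  have X: "X \<ge> 0" "X\<^sup>2 = 1 - x\<^sup>2" and Y: "Y \<ge> 0" "Y\<^sup>2 = 1 - y\<^sup>2"
    using x y by (simp_all add: X_def Y_def power_le_one)
  have W: "W \<ge> 0" "W\<^sup>2 = 1 - (x * y)\<^sup>2"
    using x y by (simp_all add: W_def power_le_one mult_le_one)
  define g where "g = x * y"
  define h where "h = X * Y"
  define M where "M = x * Y + y * X"
  have g: "g \<ge> 0" and h: "h \<ge> 0" and M: "M \<ge> 0"
    using x y X Y by (auto simp: g_def h_def M_def)
  have M2: "M\<^sup>2 = W\<^sup>2 + h * (2 * g - h)"
    using X Y W by (simp add: M_def g_def h_def power2_eq_square algebra_simps) algebra
  define d where "d = (1 + s) * (1 + t)"
  have d: "d > 0" using s t by (simp add: d_def)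
  have g2: "g\<^sup>2 = (1 - s) * (1 - t) / d"
    by (simp add: g_def power_mult_distrib x2 y2 d_def)
  have X2: "X\<^sup>2 = 2 * s / (1 + s)" and Y2: "Y\<^sup>2 = 2 * t / (1 + t)"
    using s t by (simp_all add: X Y x2 y2 field_simps)
  have h2: "h\<^sup>2 = 4 * s * t / d"
    by (simp add: h_def power_mult_distrib X2 Y2 d_def)
  have W2: "W\<^sup>2 = 2 * (s + t) / d"
  proof -
    have "W\<^sup>2 = 1 - (1 - s) * (1 - t) / d" using W g2 by (simp add: g_def)
    also have "\<dots> = 2 * (s + t) / d"
      using d by (simp add: field_simps) (simp add: d_def algebra_simps)
    finally show ?thesis .
  qed
  have W2g: "W\<^sup>2 = 1 - g\<^sup>2" using W by (simp add: g_def)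
  \<comment> \<open>Expresses the cosine of the left-hand side, \<open>(1 - 3 (s + t)) / (1 + s + t)\<close>, through \<open>g\<close> and \<open>h\<close>.\<close>
  have q1: "2 * q\<^sup>2 - 1 = 1 - 8 * W\<^sup>2 / (4 - h\<^sup>2)"
  proof -
    have "4 - h\<^sup>2 = 4 * (1 + (s + t)) / d"
      using d by (simp add: h2 field_simps) (simp add: d_def algebra_simps)
    then have "8 * W\<^sup>2 / (4 - h\<^sup>2) = (4 * (4 * (s + t))) / (4 * (1 + (s + t)))"
      using d by (simp add: W2)
    also have "\<dots> = 4 * (s + t) / (1 + (s + t))" by (rule mult_divide_mult_cancel_left) simp
    finally have "8 * W\<^sup>2 / (4 - h\<^sup>2) = 4 * (s + t) / (1 + (s + t))" .
    then show ?thesis using st by (simp add: q2 field_simps)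
  qed
  have hg: "h\<^sup>2 \<le> (2 * g)\<^sup>2"
    using st d by (simp add: power_mult_distrib h2 g2 divide_right_mono algebra_simps)
  then have hg': "h \<le> 2 * g" by (rule power2_le_imp_le) (use g in simp)
  have "W\<^sup>2 \<le> M\<^sup>2" using M2 hg' h by simp
  then have WM: "W \<le> M" using M by (rule power2_le_imp_le)
  have h1: "h \<le> 1"
    using X Y x y unfolding h_def by (intro mult_le_one) (auto simp: X_def Y_def)
  then have "h\<^sup>2 \<le> 1" using h by (simp add: power_le_one)
  then have h4: "4 - h\<^sup>2 > 0" by simp
  have key: "2 * h * W\<^sup>2 \<le> g * (4 - h\<^sup>2)"
  proof -
    have "2 * h * W\<^sup>2 \<le> 2 * (2 * g) * W\<^sup>2" using hg' by (intro mult_right_mono) auto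
    also have "\<dots> = g * (4 - (2 * g)\<^sup>2)" using W2g by algebra
    also have "\<dots> \<le> g * (4 - h\<^sup>2)" using hg g by (intro mult_left_mono) auto
    finally show ?thesis .
  qed
  \<comment> \<open>Separates \<open>8 / (4 - h\<^sup>2)\<close> into its value 2 at \<open>h = 0\<close> and a remainder that \<open>key\<close> controls.\<close>
  have "8 * W\<^sup>2 / (4 - h\<^sup>2) = 2 * W\<^sup>2 + h * (2 * h * W\<^sup>2) / (4 - h\<^sup>2)"
    using h4 by (simp add: field_simps power2_eq_square)
  also have "\<dots> \<le> 2 * W\<^sup>2 + h * g"
    using key h h4 mult_left_mono[OF key h] by (simp add: field_simps)
  finally have A: "8 * W\<^sup>2 / (4 - h\<^sup>2) \<le> 2 * W\<^sup>2 + h * g" .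
  have B: "W * W \<le> M * W" using WM W by (intro mult_right_mono) auto
  have cosum: "cos (arccos x + arccos y + arccos (x * y)) = g * (g - h) - M * W"
    using ax ay axy
    by (simp add: cos_add sin_add g_def h_def M_def X_def Y_def W_def algebra_simps)
  have cosq: "cos (2 * arccos q) = 1 - 8 * W\<^sup>2 / (4 - h\<^sup>2)"
    using aq q1 by (simp add: cos_double_cos)
  have main: "cos (arccos x + arccos y + arccos (x * y)) \<le> cos (2 * arccos q)"
    using A B W2g unfolding cosum cosq by (simp add: power2_eq_square algebra_simps)
  have sep: "sep s t = arccos (x * y)" by (simp add: sep_def x_def y_def)
  show "2 * arccos (tilt (s + t)) \<le> arccos (tilt s) + arccos (tilt t) + sep s t"
  proof (cases "arccos x + arccos y + arccos (x * y) \<le> pi")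
    case True
    then show ?thesis
      using main ax ay axy aq unfolding sep x_def[symmetric] y_def[symmetric] q_def[symmetric]
      by (subst (asm) cos_mono_le_eq) auto
  next
    case False
    then show ?thesis
      using aq unfolding sep x_def[symmetric] y_def[symmetric] q_def[symmetric] by auto
  qed
  assume pos: "0 < s" "0 < t" "s + t < 1"
  have "h\<^sup>2 < (2 * g)\<^sup>2"
    using pos d by (simp add: power_mult_distrib h2 g2 divide_strict_right_mono algebra_simps)
  then have "h < 2 * g" by (rule power2_less_imp_less) (use g in simp)
  moreover have "h \<noteq> 0" using h2 pos d by auto
  ultimately have "W\<^sup>2 < M\<^sup>2" using M2 h by simp
  then have "W < M" using M by (rule power2_less_imp_less)
  moreover have "W \<noteq> 0" using W2 pos d by auto
  ultimately have "W * W < M * W" using W by (intro mult_strict_right_mono) auto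
  then have main': "cos (arccos x + arccos y + arccos (x * y)) < cos (2 * arccos q)"
    using A W2g unfolding cosum cosq by (simp add: power2_eq_square algebra_simps)
  show "2 * arccos (tilt (s + t)) < arccos (tilt s) + arccos (tilt t) + sep s t"
  proof (cases "arccos x + arccos y + arccos (x * y) < pi")
    case True
    then show ?thesis
      using main' ax ay axy aq unfolding sep x_def[symmetric] y_def[symmetric] q_def[symmetric]
      by (subst (asm) cos_mono_less_eq) auto
  next
    case False
    have "q \<noteq> 0" using q2 pos by auto
    then have "arccos q < arccos 0" using q by (intro arccos_less_arccos) auto
    then show ?thesis
      using False unfolding sep x_def[symmetric] y_def[symmetric] q_def[symmetric] by simp
  qed
qed

lemma sep_commute: "sep s t = sep t s"
  by (simp add: sep_def mult.commute)

lemma tilt_mem: "s \<in> {0..1} \<Longrightarrow> tilt s \<in> {0..1}"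
  using tilt_bounds[of s] by auto

lemma sep_triangle:
  assumes "r \<in> {0..1}" "s \<in> {0..1}" "t \<in> {0..1}"
  shows "sep r t \<le> sep r s + sep s t"
  unfolding sep_def using assms by (intro arccos_mult_triangle tilt_mem)

lemma sep_shift:
  assumes "a \<in> {0..1}" "0 \<le> s" "s \<le> t" "t \<le> 1"
  shows "sep a t - sep a s \<le> arccos (tilt t) - arccos (tilt s)"
  unfolding sep_def using assms tilt_bounds[of s] tilt_bounds[of t] tilt_antimono[of s t]
  by (intro arccos_mult_shift tilt_mem) auto

text \<open>
  Turning to the merged vector costs the left neighbour at most \<open>arccos (tilt (s + t)) - arccos (tilt s)\<close> and
  the right one at most the same with \<open>t\<close>; the angle \<open>sep s t\<close> between the merged vectors pays for both.
\<close>

lemma sep_merge: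
  assumes "a \<in> {0..1}" "b \<in> {0..1}" "0 \<le> s" "0 \<le> t" "s + t \<le> 1"
  shows "sep a (s + t) + sep (s + t) b \<le> sep a s + sep s t + sep t b"
    and "\<lbrakk>0 < s; 0 < t; s + t < 1\<rbrakk> \<Longrightarrow>
      sep a (s + t) + sep (s + t) b < sep a s + sep s t + sep t b"
proof -
  have "sep a (s + t) - sep a s \<le> arccos (tilt (s + t)) - arccos (tilt s)"
    "sep b (s + t) - sep b t \<le> arccos (tilt (s + t)) - arccos (tilt t)"
    using assms by (auto intro!: sep_shift)
  note shifts = this[unfolded sep_commute[of b]]
  show "sep a (s + t) + sep (s + t) b \<le> sep a s + sep s t + sep t b"
    using shifts arccos_tilt_add(1)[OF assms(3-5)] by linarith
  show "sep a (s + t) + sep (s + t) b < sep a s + sep s t + sep t b"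
    if "0 < s" "0 < t" "s + t < 1"
    using shifts arccos_tilt_add(2)[OF assms(3-5) that] by linarith
qed

text \<open>
  With \<open>u\<close>, \<open>v\<close>, \<open>t\<close> the squared tilts, the condition that the three angles sum to at most \<open>\<pi>\<close> becomes
  \<open>u v + v t + t u + 2 u v t \<ge> 1\<close>, that is \<open>1 / (1 + u) + 1 / (1 + v) + 1 / (1 + t) \<le> 2\<close>, and each of these terms
  is half of 1 plus an excess.
\<close>

lemma sep_triple:
  assumes "a \<in> {0..1}" "b \<in> {0..1}" "c \<in> {0..1}"
  shows "sep a b + sep b c + sep c a \<le> pi \<Longrightarrow> a + b + c \<le> 1"
    and "sep a b + sep b c + sep c a < pi \<Longrightarrow> a + b + c < 1"
proof -
  define x where "x = tilt a * tilt b"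
  define y where "y = tilt b * tilt c"
  define w where "w = tilt c * tilt a"
  note m = tilt_mem[OF assms(1)] tilt_mem[OF assms(2)] tilt_mem[OF assms(3)]
  note ab = arccos_mult_bounds[OF m(1,2)] and bc = arccos_mult_bounds[OF m(2,3)]
    and ca = arccos_mult_bounds[OF m(3,1)]
  have nn: "x \<ge> 0" "y \<ge> 0" "w \<ge> 0" "x \<le> 1" "y \<le> 1"
    using m by (auto simp: x_def y_def w_def mult_le_one)
  have cs: "cos (sep a b + sep b c) = x * y - sqrt ((1 - x\<^sup>2) * (1 - y\<^sup>2))"
    using ab bc by (simp add: cos_add sep_def x_def y_def real_sqrt_mult)
  have cw: "cos (pi - sep c a) = - w" using ca by (simp add: sep_def w_def)
  have D: "(1 - x\<^sup>2) * (1 - y\<^sup>2) \<ge> 0" using nn by (simp add: power_le_one)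
  have sq: "(1 - x\<^sup>2) * (1 - y\<^sup>2) - (x * y + w)\<^sup>2 =
      4 * (a + b + c - 1) / ((1 + a) * (1 + b) * (1 + c))" (is "_ = ?R")
  proof -
    define u v t where "u = (tilt a)\<^sup>2" and "v = (tilt b)\<^sup>2" and "t = (tilt c)\<^sup>2"
    have "(1 - x\<^sup>2) * (1 - y\<^sup>2) - (x * y + w)\<^sup>2 = 1 - u * v - v * t - t * u - 2 * u * v * t"
      by (simp add: x_def y_def w_def u_def v_def t_def power2_eq_square algebra_simps)
    also have "\<dots> = ?R"
    proof -
      have u: "u = (1 - a) / (1 + a)" "v = (1 - b) / (1 + b)" "t = (1 - c) / (1 + c)"
        using assms by (auto simp: u_def v_def t_def tilt_square)
      show ?thesis unfolding u using assms
        by (simp add: divide_simps) (auto simp: algebra_simps)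
    qed
    finally show ?thesis .
  qed
  have "(1 + a) * (1 + b) * (1 + c) > 0" using assms by auto
  then have neg: "4 * (a + b + c - 1) / ((1 + a) * (1 + b) * (1 + c)) \<le> 0 \<Longrightarrow> a + b + c \<le> 1"
    "4 * (a + b + c - 1) / ((1 + a) * (1 + b) * (1 + c)) < 0 \<Longrightarrow> a + b + c < 1"
    by (simp_all only: divide_le_0_iff divide_less_0_iff) auto
  {
    assume "sep a b + sep b c + sep c a \<le> pi"
    then have "cos (pi - sep c a) \<le> cos (sep a b + sep b c)"
      using ab bc ca by (subst cos_mono_le_eq) (auto simp: sep_def)
    then have "sqrt ((1 - x\<^sup>2) * (1 - y\<^sup>2)) \<le> x * y + w" using cs cw by simp
    then have "(1 - x\<^sup>2) * (1 - y\<^sup>2) \<le> (x * y + w)\<^sup>2" by (rule sqrt_le_D)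
    then show "a + b + c \<le> 1" using sq neg(1) by linarith
  }
  {
    assume "sep a b + sep b c + sep c a < pi"
    then have "cos (pi - sep c a) < cos (sep a b + sep b c)"
      using ab bc ca by (subst cos_mono_less_eq) (auto simp: sep_def)
    then have "sqrt ((1 - x\<^sup>2) * (1 - y\<^sup>2)) < x * y + w" using cs cw by simp
    then have "(sqrt ((1 - x\<^sup>2) * (1 - y\<^sup>2)))\<^sup>2 < (x * y + w)\<^sup>2"
      using D by (intro power_strict_mono) auto
    then have "(1 - x\<^sup>2) * (1 - y\<^sup>2) < (x * y + w)\<^sup>2" using D by simp
    then show "a + b + c < 1" using sq neg(2) by linarith
  }
qed

section \<open>Merging along a cycle of excesses\<close>
fun sep_path :: "real list \<Rightarrow> real" where
  "sep_path (s # t # xs) = sep s t + sep_path (t # xs)"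
| "sep_path _ = 0"

lemma sep_le_sep_path:
  assumes "set (s # xs @ [t]) \<subseteq> {0..1}"
  shows "sep s t \<le> sep_path (s # xs @ [t])"
  using assms
proof (induction xs arbitrary: s)
  case (Cons x xs)
  then show ?case using sep_triangle[of s x t] by fastforce
qed simp

text \<open>
  Merging two excesses makes sense only if their sum is at most 1. The cycle itself guarantees this:
  by the triangle inequality, dropping all but three of its members does not lengthen it.
\<close>

lemma sum_adjacent_le_1:
  assumes "set (a # s # t # xs @ [b]) \<subseteq> {0..1}"
    and "sep_path (a # s # t # xs @ [b]) + sep b a \<le> pi"
  shows "s + t + b \<le> 1"
proof -
  have "sep t b \<le> sep_path (t # xs @ [b])" using assms by (intro sep_le_sep_path) auto
  moreover have "sep b s \<le> sep b a + sep a s" using assms by (intro sep_triangle) auto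
  ultimately have "sep s t + sep t b + sep b s \<le> pi" using assms(2) by simp
  then show ?thesis using assms by (intro sep_triple) auto
qed

lemma sep_path_merge:
  assumes "set (a # s # t # xs @ [b]) \<subseteq> {0..1}" "s + t \<le> 1"
  shows "sep_path (a # (s + t) # xs @ [b]) \<le> sep_path (a # s # t # xs @ [b])"
    and "\<lbrakk>0 < s; 0 < t; s + t < 1\<rbrakk> \<Longrightarrow>
      sep_path (a # (s + t) # xs @ [b]) < sep_path (a # s # t # xs @ [b])"
proof -
  obtain c ys where c: "xs @ [b] = c # ys" by (cases "xs @ [b]") auto
  have "c \<in> set (xs @ [b])" unfolding c by simp
  then have m: "a \<in> {0..1}" "c \<in> {0..1}" "0 \<le> s" "0 \<le> t" using assms by auto
  show "sep_path (a # (s + t) # xs @ [b]) \<le> sep_path (a # s # t # xs @ [b])"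
    using sep_merge(1)[OF m assms(2)] by (simp add: c)
  show "sep_path (a # (s + t) # xs @ [b]) < sep_path (a # s # t # xs @ [b])"
    if "0 < s" "0 < t" "s + t < 1"
    using sep_merge(2)[OF m assms(2) that] by (simp add: c)
qed

text \<open>Merging the second and third member repeatedly shortens the cycle to a triple.\<close>

lemma sep_cycle:
  assumes "set (a # x # xs @ [b]) \<subseteq> {0..1}"
  shows "sep_path (a # x # xs @ [b]) + sep b a \<le> pi \<Longrightarrow> a + x + sum_list xs + b \<le> 1"
    and "sep_path (a # x # xs @ [b]) + sep b a < pi \<Longrightarrow> a + x + sum_list xs + b < 1"
  using assms
proof (induction xs arbitrary: x)
  case Nil
  { case 1 then show ?case using sep_triple(1)[of a x b] by simp }
  { case 2 then show ?case using sep_triple(2)[of a x b] by simp }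
next
  case (Cons y xs)
  {
    case 1
    then have "x + y + b \<le> 1" by (intro sum_adjacent_le_1) auto
    then have le: "x + y \<le> 1" using 1 by auto
    have "sep_path (a # (x + y) # xs @ [b]) \<le> sep_path (a # x # y # xs @ [b])"
      using 1 le by (intro sep_path_merge) auto
    then show ?case using Cons.IH(1)[of "x + y"] 1 le by auto
  }
  {
    case 2
    then have "x + y + b \<le> 1" by (intro sum_adjacent_le_1[of a x y xs b]) auto
    then have le: "x + y \<le> 1" using 2 by auto
    have "sep_path (a # (x + y) # xs @ [b]) \<le> sep_path (a # x # y # xs @ [b])"
      using 2 le by (intro sep_path_merge) auto
    then show ?case using Cons.IH(2)[of "x + y"] 2 le by auto
  }
qed

text \<open>Merging \<open>x\<close> and \<open>y\<close> is strict because \<open>x + y + b \<le> 1\<close> and \<open>b > 0\<close> keep their sum below 1.\<close>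

lemma sep_cycle_strict:
  assumes "set (a # x # y # xs @ [b]) \<subseteq> {0..1}" "0 < x" "0 < y" "0 < b"
    and "sep_path (a # x # y # xs @ [b]) + sep b a \<le> pi"
  shows "a + x + y + sum_list xs + b < 1"
proof -
  have "x + y + b \<le> 1" using assms by (intro sum_adjacent_le_1) auto
  then have lt: "x + y < 1" using assms by simp
  have "sep_path (a # (x + y) # xs @ [b]) < sep_path (a # x # y # xs @ [b])"
    using assms lt by (intro sep_path_merge) auto
  then show ?thesis using sep_cycle(2)[of a "x + y" xs b] assms lt by auto
qed

section \<open>From plane vectors to excesses\<close>

text \<open>The perimeter of the triangle with sides \<open>z\<close>, \<open>w\<close> and \<open>- (z + w)\<close>.\<close>

abbreviation perimeter :: "complex \<Rightarrow> complex \<Rightarrow> real" where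
  "perimeter z w \<equiv> cmod z + cmod w + cmod (z + w)"

lemma perimeter_commute: "perimeter z w = perimeter w z"
  by (simp add: add.commute)

lemma perimeter_imp_norm_le:
  assumes "perimeter z w \<le> 4"
  shows "cmod z \<le> 2"
  using assms norm_triangle_ineq4[of "z + w" w] by simp

text \<open>
  Squaring \<open>|z + w| \<le> 4 - |z| - |w|\<close> gives a bound on the inner product \<open>z \<bullet> w = Re (z * cnj w)\<close> whose correction
  term is linear in the excesses.
\<close>

lemma perimeter_imp_inner_le:
  assumes "perimeter z w \<le> 4"
  shows "Re (z * cnj w) \<le> cmod z * cmod w - 4 * ((cmod z - 1) + (cmod w - 1))"
proof -
  have "(cmod (z + w))\<^sup>2 \<le> (4 - cmod z - cmod w)\<^sup>2"
    using assms by (intro power_mono) auto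
  moreover have "(cmod (z + w))\<^sup>2 = (cmod z)\<^sup>2 + (cmod w)\<^sup>2 + 2 * Re (z * cnj w)"
    unfolding cmod_power2 by (simp add: power2_eq_square algebra_simps)
  ultimately show ?thesis by (simp add: power2_eq_square algebra_simps)
qed

text \<open>
  Sum the three inner product bounds. The second claim follows because the left-hand side is nonnegative
  and \<open>S \<le> 3\<close>, each norm being at most 2.
\<close>

lemma perimeter_triple:
  assumes "perimeter z w \<le> 4" "perimeter w v \<le> 4" "perimeter v z \<le> 4"
  defines "S \<equiv> (cmod z - 1) + (cmod w - 1) + (cmod v - 1)"
  shows "(cmod (z + w + v))\<^sup>2 \<le> (1 - S) * (9 - S)" and "S \<le> 1"
proof -
  note i = assms(1-3)[THEN perimeter_imp_inner_le]
  have "(cmod (z + w + v))\<^sup>2 = (cmod z)\<^sup>2 + (cmod w)\<^sup>2 + (cmod v)\<^sup>2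
      + 2 * Re (z * cnj w) + 2 * Re (w * cnj v) + 2 * Re (v * cnj z)"
    unfolding cmod_power2 by (simp add: power2_eq_square algebra_simps)
  also have "\<dots> \<le> (cmod z + cmod w + cmod v)\<^sup>2 - 16 * S"
    using i by (simp add: S_def power2_eq_square algebra_simps)
  also have "\<dots> = (1 - S) * (9 - S)"
    by (simp add: S_def power2_eq_square algebra_simps)
  finally show le: "(cmod (z + w + v))\<^sup>2 \<le> (1 - S) * (9 - S)" .
  have "0 \<le> (1 - S) * (9 - S)" using le zero_le_power2 order_trans by blast
  moreover have "9 - S > 0" using assms(1-3)[THEN perimeter_imp_norm_le] by (simp add: S_def)
  ultimately show "S \<le> 1" by (simp add: zero_le_mult_iff)
qed

text \<open>
  The direction \<open>e\<close> is the origin of the angles. Angles up to \<open>2 \<pi>\<close> are admitted, since the gap between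
  angular neighbours may exceed \<open>\<pi>\<close>; then \<open>cos \<delta>\<close> is negative and the claim all the weaker.
\<close>

lemma sep_le_half_angle:
  assumes "perimeter z w \<le> 4" "1 \<le> cmod z" "1 \<le> cmod w" "cmod e = 1"
    and z: "z = complex_of_real (cmod z) * (e * cis \<alpha>)"
    and w: "w = complex_of_real (cmod w) * (e * cis \<beta>)"
    and "0 \<le> \<beta> - \<alpha>" "\<beta> - \<alpha> \<le> 2 * pi"
  shows "sep (cmod z - 1) (cmod w - 1) \<le> (\<beta> - \<alpha>) / 2"
proof -
  define r q where "r = cmod z" and "q = cmod w"
  define \<delta> where "\<delta> = (\<beta> - \<alpha>) / 2"
  have r: "1 \<le> r" "r \<le> 2" and q: "1 \<le> q" "q \<le> 2"
    using assms perimeter_imp_norm_le[of z w] perimeter_imp_norm_le[of w z]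
    by (auto simp: r_def q_def perimeter_commute)
  have ee: "e * cnj e = 1" using assms(4) by (simp add: complex_norm_square[symmetric])
  have "z * cnj w = of_real (r * q) * ((e * cnj e) * (cis \<alpha> * cnj (cis \<beta>)))"
    by (subst z, subst w) (simp add: r_def q_def)
  also have "\<dots> = of_real (r * q) * cis (\<alpha> - \<beta>)"
    unfolding ee by (simp add: cis_cnj cis_mult)
  finally have "Re (z * cnj w) = r * q * cos (\<beta> - \<alpha>)"
    using cos_minus[of "\<beta> - \<alpha>"] by simp
  also have "\<beta> - \<alpha> = 2 * \<delta>" by (simp add: \<delta>_def)
  finally have "r * q * (2 * (cos \<delta>)\<^sup>2 - 1) \<le> r * q - 4 * ((r - 1) + (q - 1))"
    using perimeter_imp_inner_le[OF assms(1)] by (simp add: cos_double_cos r_def q_def)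
  then have "r * q * (cos \<delta>)\<^sup>2 \<le> (2 - r) * (2 - q)" by (simp add: algebra_simps)
  then have "(cos \<delta>)\<^sup>2 \<le> (2 - r) * (2 - q) / (r * q)"
    using r q by (simp add: field_simps)
  also have "\<dots> = (tilt (r - 1) * tilt (q - 1))\<^sup>2"
    using r q by (simp add: tilt_square power_mult_distrib)
  finally have "\<bar>cos \<delta>\<bar> \<le> \<bar>tilt (r - 1) * tilt (q - 1)\<bar>" by (simp add: abs_le_square_iff)
  then have "cos \<delta> \<le> tilt (r - 1) * tilt (q - 1)"
    using tilt_bounds[of "r - 1"] tilt_bounds[of "q - 1"] r q by simp
  moreover have "tilt (r - 1) * tilt (q - 1) \<le> 1"
    using tilt_bounds[of "r - 1"] tilt_bounds[of "q - 1"] r q by (intro mult_le_one) auto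
  ultimately have "sep (r - 1) (q - 1) \<le> arccos (cos \<delta>)"
    unfolding sep_def by (intro arccos_le_arccos) auto
  also have "\<dots> = \<delta>" using assms by (intro arccos_cos) (auto simp: \<delta>_def)
  finally show ?thesis by (simp add: \<delta>_def r_def q_def)
qed

text \<open>The half angles between neighbours telescope.\<close>

lemma sep_path_le_half_angle:
  assumes "sorted_wrt (\<lambda>k l. sep (s k) (s l) \<le> (\<theta> l - \<theta> k) / 2) (x # xs)"
  shows "sep_path (map s (x # xs)) \<le> (\<theta> (last (x # xs)) - \<theta> x) / 2"
  using assms
proof (induction xs arbitrary: x)
  case (Cons y ys)
  from Cons.prems have "sep (s x) (s y) \<le> (\<theta> y - \<theta> x) / 2"
    and "sorted_wrt (\<lambda>k l. sep (s k) (s l) \<le> (\<theta> l - \<theta> k) / 2) (y # ys)"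
    by simp_all
  moreover from this(2) have "sep_path (map s (y # ys)) \<le> (\<theta> (last (y # ys)) - \<theta> y) / 2"
    by (rule Cons.IH)
  ultimately show ?case by (simp add: field_simps)
qed simp

lemma exists_angle:
  assumes "cmod e = 1"
  shows "\<exists>t. 0 \<le> t \<and> t < 2 * pi \<and> z = complex_of_real (cmod z) * (e * cis t)"
proof -
  define a where "a = Arg (z / e)"
  define t where "t = (if a < 0 then a + 2 * pi else a)"
  have e: "e \<noteq> 0" using assms by auto
  have "cis t = cis a" by (simp add: t_def cis_mult[symmetric])
  moreover have "z / e = rcis (cmod z) a"
    using rcis_cmod_Arg[of "z / e"] assms by (simp add: a_def norm_divide)
  ultimately have "z = complex_of_real (cmod z) * (e * cis t)"
    using e by (simp add: rcis_def field_simps)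
  moreover have "- pi < a" "a \<le> pi" using Arg_bounded[of "z / e"] by (auto simp: a_def)
  ultimately show ?thesis by (intro exI[of _ t]) (auto simp: t_def)
qed

lemma sorted_distinct_key_list:
  fixes f :: "'a \<Rightarrow> real"
  assumes "finite A"
  obtains xs where "set xs = A" "length xs = card A" "sorted_wrt (\<lambda>k l. f k \<le> f l \<and> k \<noteq> l) xs"
proof -
  obtain ys where ys: "set ys = A" "distinct ys" using finite_distinct_list[OF assms] by blast
  define xs where "xs = sort_key f ys"
  have xs: "set xs = A" "distinct xs" "sorted (map f xs)" using ys by (auto simp: xs_def)
  have "sorted_wrt (\<lambda>k l. f k \<le> f l \<and> k \<noteq> l) xs"
    using xs(2,3) by (induction xs) auto
  then show thesis using that[of xs] xs(1,2) distinct_card[of xs] by simp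
qed

text \<open>
  Only \<open>z c\<close> may have excess 0. Its direction serves as angle 0, so that it comes first in the angular order and the
  two members that follow it have positive excess, as the strict merge requires.
\<close>

lemma excess_sum_less:
  fixes z :: "'a \<Rightarrow> complex"
  assumes "finite B" "3 \<le> card B" "c \<notin> B"
    and perim: "\<And>k l. \<lbrakk>k \<in> insert c B; l \<in> insert c B; k \<noteq> l\<rbrakk> \<Longrightarrow> perimeter (z k) (z l) \<le> 4"
    and c: "1 \<le> cmod (z c)" and B: "\<And>k. k \<in> B \<Longrightarrow> 1 < cmod (z k)"
  shows "(cmod (z c) - 1) + (\<Sum>k\<in>B. cmod (z k) - 1) < 1"
proof -
  define s where "s = (\<lambda>k. cmod (z k) - 1)"
  define e where "e = sgn (z c)"
  have e: "cmod e = 1" using c by (auto simp: e_def norm_sgn)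
  have "\<forall>k. \<exists>t. 0 \<le> t \<and> t < 2 * pi \<and> z k = complex_of_real (cmod (z k)) * (e * cis t)"
    using exists_angle[OF e] by blast
  then obtain \<theta>' where \<theta>': "\<And>k. 0 \<le> \<theta>' k" "\<And>k. \<theta>' k < 2 * pi"
    "\<And>k. z k = complex_of_real (cmod (z k)) * (e * cis (\<theta>' k))" by metis
  define \<theta> where "\<theta> = \<theta>'(c := 0)"
  have \<theta>: "\<And>k. 0 \<le> \<theta> k" "\<And>k. \<theta> k < 2 * pi"
    "\<And>k. z k = complex_of_real (cmod (z k)) * (e * cis (\<theta> k))"
    using \<theta>' c by (auto simp: \<theta>_def e_def sgn_eq)
  have ge: "1 \<le> cmod (z k)" if "k \<in> insert c B" for k using that c B by (auto intro: less_imp_le)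
  have sep: "sep (s k) (s l) \<le> (\<theta> l - \<theta> k) / 2"
    if "k \<in> insert c B" "l \<in> insert c B" "k \<noteq> l" "\<theta> k \<le> \<theta> l" for k l
    unfolding s_def using that \<theta>(1)[of k] \<theta>(2)[of l]
    by (intro sep_le_half_angle[OF perim[OF that(1-3)] ge[OF that(1)] ge[OF that(2)] e \<theta>(3) \<theta>(3)]) auto
  obtain xs where xs: "set xs = B" "length xs = card B"
    "sorted_wrt (\<lambda>k l. \<theta> k \<le> \<theta> l \<and> k \<noteq> l) xs"
    using sorted_distinct_key_list[OF assms(1)] by blast
  obtain x ys where "xs = x # ys" using xs(2) assms(2) by (cases xs) auto
  moreover obtain y ws where "ys = y # ws" using calculation xs(2) assms(2) by (cases ys) auto
  moreover obtain us b where "ws = us @ [b]"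
    using calculation xs(2) assms(2) by (cases ws rule: rev_cases) auto
  ultimately have form: "xs = x # y # us @ [b]" by simp
  have mem: "s k \<in> {0..1}" if k: "k \<in> insert c B" for k
  proof -
    obtain l where "l \<in> insert c B" "l \<noteq> k"
      using assms(2,3) k by (metis card.empty insertCI not_numeral_le_zero equals0I)
    then have "cmod (z k) \<le> 2" using perim[OF k] perimeter_imp_norm_le by metis
    then show ?thesis using ge[OF k] by (simp add: s_def)
  qed
  have bB: "b \<in> B" "x \<in> B" "y \<in> B" using xs(1) form by auto
  \<comment> \<open>The closing gap, from the last vector on to \<open>z c\<close> at angle \<open>2 \<pi>\<close>.\<close>
  have cb: "sep (s b) (s c) \<le> (2 * pi - \<theta> b) / 2"
    unfolding s_def
  proof (rule sep_le_half_angle[OF perim _ _ e \<theta>(3), of b c "2 * pi"])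
    show "z c = complex_of_real (cmod (z c)) * (e * cis (2 * pi))"
      using \<theta>(3)[of c] by (simp add: \<theta>_def)
  qed (use bB ge \<theta>(1)[of b] \<theta>(2)[of b] assms(3) in auto)
  have "sorted_wrt (\<lambda>k l. sep (s k) (s l) \<le> (\<theta> l - \<theta> k) / 2) (c # xs)"
  proof -
    have "sorted_wrt (\<lambda>k l. sep (s k) (s l) \<le> (\<theta> l - \<theta> k) / 2) xs"
      by (rule sorted_wrt_mono_rel[OF _ xs(3)]) (use xs(1) sep in auto)
    moreover have "sep (s c) (s k) \<le> (\<theta> k - \<theta> c) / 2" if "k \<in> set xs" for k
      using that xs(1) assms(3) \<theta>(1)[of k] by (intro sep) (auto simp: \<theta>_def)
    ultimately show ?thesis by simp
  qed
  then have "sep_path (map s (c # xs)) \<le> (\<theta> b - \<theta> c) / 2"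
    using sep_path_le_half_angle[of s \<theta> c xs] by (simp add: form)
  with cb have "sep_path (map s (c # xs)) + sep (s b) (s c) \<le> pi"
    by (simp add: \<theta>_def field_simps)
  moreover have "set (map s (c # xs)) \<subseteq> {0..1}" using mem xs(1) by auto
  moreover have "0 < s x" "0 < s y" "0 < s b" using bB B by (auto simp: s_def)
  ultimately have "s c + s x + s y + sum_list (map s us) + s b < 1"
    by (intro sep_cycle_strict) (auto simp: form)
  moreover have "sum s B = sum_list (map s xs)"
  proof -
    have "distinct xs" using xs(1,2) by (simp add: card_distinct)
    then show ?thesis using xs(1) sum_list_distinct_conv_sum_set by metis
  qed
  ultimately show ?thesis by (simp add: form s_def)
qed

lemma sum_eq_0_nonpos:
  fixes f :: "'a \<Rightarrow> real"
  assumes "finite A" "\<And>x. x \<in> A \<Longrightarrow> f x \<le> 0" "sum f A = 0" "x \<in> A"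
  shows "f x = 0"
  using sum_nonneg_eq_0_iff[of A "\<lambda>x. - f x"] assms by (simp add: sum_negf)

section \<open>The extremal configurations\<close>
text \<open>
  A total excess of 1 needs a pair whose excesses sum to at least 1. For such a pair the triple bound holds the
  other excesses down, and equality throughout makes every triple that contains the pair sum to zero.
\<close>

lemma extremal_structure:
  fixes z :: "'a \<Rightarrow> complex"
  assumes "finite I" "4 \<le> card I"
    and perim: "\<And>k l. \<lbrakk>k \<in> I; l \<in> I; k \<noteq> l\<rbrakk> \<Longrightarrow> perimeter (z k) (z l) \<le> 4"
    and total: "1 \<le> (\<Sum>k\<in>I. cmod (z k) - 1)"
  obtains i j where "i \<in> I" "j \<in> I" "i \<noteq> j" "cmod (z i + z j) = 1"
    "\<And>k. k \<in> I - {i, j} \<Longrightarrow> z k = - (z i + z j)"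
proof -
  define s where "s = (\<lambda>k. cmod (z k) - 1)"
  have total: "1 \<le> sum s I" using total by (simp add: s_def)
  have triple: "(cmod (z i + z j + z k))\<^sup>2 \<le> (1 - (s i + s j + s k)) * (9 - (s i + s j + s k))"
    "s i + s j + s k \<le> 1"
    if "i \<in> I" "j \<in> I" "k \<in> I" "i \<noteq> j" "j \<noteq> k" "k \<noteq> i" for i j k
    using perimeter_triple[OF perim[OF that(1,2,4)] perim[OF that(2,3,5)] perim[OF that(3,1,6)]]
    by (auto simp: s_def)
  have split: "sum s I = sum s U + sum s (I - U)" if "U \<subseteq> I" for U
    using sum.subset_diff[OF that assms(1), of s] by simp
  have "\<exists>i\<in>I. \<exists>j\<in>I. i \<noteq> j \<and> 1 \<le> s i + s j"
  proof (rule ccontr)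
    assume "\<not> ?thesis"
    then have pair: "s i + s j < 1" if "i \<in> I" "j \<in> I" "i \<noteq> j" for i j
      using that by force
    define T where "T = {k \<in> I. 0 < s k}"
    have T: "T \<subseteq> I" "finite T" using assms(1) by (auto simp: T_def)
    have rest: "sum s (I - U) \<le> 0" if "T \<subseteq> U" for U
      using that by (intro sum_nonpos) (auto simp: T_def)
    consider "card T \<le> 2" | "card T = 3" | "4 \<le> card T" by linarith
    then show False
    proof cases
      case 1
      then obtain U where U: "T \<subseteq> U" "U \<subseteq> I" "card U = 2"
        using exists_subset_between[of T 2 I] T assms(1,2) by auto
      then obtain i j where ij: "U = {i, j}" "i \<noteq> j" by (auto simp: card_2_iff)
      then have "sum s U < 1" using U(2) pair[of i j] by simp
      then show False using split[OF U(2)] rest[OF U(1)] total by linarith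
    next
      case 2
      then obtain i j k where ijk: "T = {i, j, k}" "i \<noteq> j" "j \<noteq> k" "k \<noteq> i"
        by (auto simp: card_3_iff)
      then have T1: "sum s T \<le> 1" using triple(2)[of i j k] T by auto
      have rest0: "sum s (I - T) = 0" using T1 total split[OF T(1)] rest[of T] by simp
      have zero: "s k = 0" if "k \<in> I - T" for k
        by (rule sum_eq_0_nonpos[OF _ _ rest0 that])
          (use assms(1) in \<open>auto simp: T_def\<close>)
      have "card (I - T) > 0" using 2 assms(1,2) T by (simp add: card_Diff_subset)
      then obtain c where c: "c \<in> I - T" by (auto simp: card_gt_0_iff)
      \<comment> \<open>Equality in the triple bound is excluded by a fourth vector of norm 1.\<close>
      have "(cmod (z c) - 1) + (\<Sum>k\<in>T. cmod (z k) - 1) < 1"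
        using T c 2 zero[OF c] by (intro excess_sum_less perim) (auto simp: T_def s_def)
      then show False
        using zero[OF c] rest0 split[OF T(1)] total by (simp add: s_def)
    next
      case 3
      then obtain c where c: "c \<in> T" by fastforce
      have "(cmod (z c) - 1) + (\<Sum>k\<in>T - {c}. cmod (z k) - 1) < 1"
        using T c 3 by (intro excess_sum_less perim) (auto simp: T_def s_def)
      also have "(cmod (z c) - 1) + (\<Sum>k\<in>T - {c}. cmod (z k) - 1) = sum s T"
        using T c by (simp add: s_def sum.remove)
      finally show False using split[OF T(1)] rest[of T] total by simp
    qed
  qed
  then obtain i j where ij: "i \<in> I" "j \<in> I" "i \<noteq> j" "1 \<le> s i + s j" by blast
  define J where "J = I - {i, j}"
  have J: "finite J" "card J \<ge> 2" using assms(1,2) ij by (auto simp: J_def card_Diff_subset)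
  have sJ: "s k \<le> 1 - (s i + s j)" if "k \<in> J" for k
    using that ij triple(2)[of i j k] by (auto simp: J_def)
  have tot: "sum s I = s i + s j + sum s J" using split[of "{i, j}"] ij by (simp add: J_def)
  \<comment> \<open>As \<open>J\<close> has at least two members, the deficit \<open>1 - (s i + s j)\<close> counts at least twice and outweighs the surplus.\<close>
  have "sum s J \<le> real (card J) * (1 - (s i + s j))" using sJ by (rule sum_bounded_above)
  also have "\<dots> \<le> 2 * (1 - (s i + s j))"
    using J ij by (intro mult_right_mono_neg) auto
  finally have "s i + s j = 1" using tot total ij by simp
  then have le: "s k \<le> 0" if "k \<in> J" for k using sJ[OF that] by simp
  have "sum s J = 0" using sum_nonpos[of J s] le tot total \<open>s i + s j = 1\<close> by force
  then have zero: "s k = 0" if "k \<in> J" for k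
    using sum_eq_0_nonpos[OF J(1) le \<open>sum s J = 0\<close> that] by simp
  have eq: "z k = - (z i + z j)" if k: "k \<in> J" for k
  proof -
    have "(cmod (z i + z j + z k))\<^sup>2 \<le> 0"
      using triple(1)[of i j k] k ij zero[OF k] \<open>s i + s j = 1\<close> by (auto simp: J_def)
    then have "z k + (z i + z j) = 0" by (simp add: add.commute)
    then show ?thesis by (simp only: eq_neg_iff_add_eq_0)
  qed
  obtain k where k: "k \<in> J" using J by fastforce
  have "cmod (z k) = cmod (z i + z j)" unfolding eq[OF k] by (rule norm_minus_cancel)
  then have "cmod (z i + z j) = 1" using zero[OF k] by (simp add: s_def)
  with ij eq that show thesis by (auto simp: J_def)
qed

lemma pair_max_le_iff:
  assumes "2 \<le> n"
  shows "pair_max n w \<le> M \<longleftrightarrow> (\<forall>k\<in>{1..n}. \<forall>l\<in>{1..n}. k \<noteq> l \<longrightarrow> perimeter (w k) (w l) \<le> M)"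
proof -
  define A where "A = {perimeter (w k) (w l) | k l. 1 \<le> k \<and> k < l \<and> l \<le> n}"
  have "A \<subseteq> (\<lambda>(k, l). perimeter (w k) (w l)) ` ({1..n} \<times> {1..n})" by (force simp: A_def)
  then have "finite A" by (rule finite_subset) simp
  moreover have "perimeter (w 1) (w 2) \<in> A" using assms unfolding A_def by force
  ultimately have "pair_max n w \<le> M \<longleftrightarrow> (\<forall>x\<in>A. x \<le> M)"
    unfolding pair_max_def A_def by (subst Max_le_iff) auto
  also have "\<dots> \<longleftrightarrow> (\<forall>k l. 1 \<le> k \<and> k < l \<and> l \<le> n \<longrightarrow> perimeter (w k) (w l) \<le> M)"
    by (auto simp: A_def)
  also have "\<dots> \<longleftrightarrow> (\<forall>k\<in>{1..n}. \<forall>l\<in>{1..n}. k \<noteq> l \<longrightarrow> perimeter (w k) (w l) \<le> M)"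
  proof (intro iffI ballI impI)
    fix k l
    assume *: "\<forall>k l. 1 \<le> k \<and> k < l \<and> l \<le> n \<longrightarrow> perimeter (w k) (w l) \<le> M"
      and "k \<in> {1..n}" "l \<in> {1..n}" "k \<noteq> l"
    then have "k < l \<and> 1 \<le> k \<and> l \<le> n \<or> l < k \<and> 1 \<le> l \<and> k \<le> n" by auto
    then show "perimeter (w k) (w l) \<le> M" using * perimeter_commute by metis
  qed auto
  finally show ?thesis .
qed

lemma perimeter_scale:
  assumes "0 \<le> c"
  shows "perimeter (complex_of_real c * z) (complex_of_real c * w) = c * perimeter z w"
  using assms by (simp add: norm_mult distrib_left[of c] flip: distrib_left[of "complex_of_real c"])

lemma pair_max_scale:
  assumes "2 \<le> n" "0 < c"
  shows "pair_max n (\<lambda>k. complex_of_real c * w k) = c * pair_max n w"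
proof -
  have "pair_max n (\<lambda>k. complex_of_real c * w k) \<le> M \<longleftrightarrow> c * pair_max n w \<le> M" for M
  proof -
    have c: "c * x \<le> M \<longleftrightarrow> x \<le> M / c" for x using assms(2) by (simp add: field_simps)
    have "0 \<le> c" using assms(2) by simp
    then show ?thesis
      unfolding c pair_max_le_iff[OF assms(1)] by (simp only: perimeter_scale c)
  qed
  then show ?thesis by (meson antisym order_refl)
qed

text \<open>
  The asserted structure without permutations: \<open>i\<close> and \<open>j\<close> are the two exceptional indices. The sum of
  the norms appears in place of its normalised value, which makes the property invariant under scaling.
\<close>

definition extremal_form :: "nat \<Rightarrow> (nat \<Rightarrow> complex) \<Rightarrow> bool" where
  "extremal_form n w \<longleftrightarrow> (\<exists>i\<in>{1..n}. \<exists>j\<in>{1..n}. i \<noteq> j \<and>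
     (\<forall>k\<in>{1..n} - {i, j}. w k = - (w i + w j)) \<and>
     cmod (w i + w j) = (\<Sum>k=1..n. cmod (w k)) / (real n + 1))"

lemma extremal_form_scale:
  assumes "c > 0"
  shows "extremal_form n (\<lambda>k. complex_of_real c * w k) \<longleftrightarrow> extremal_form n w"
proof -
  have "complex_of_real c * w k = - (complex_of_real c * w i + complex_of_real c * w j) \<longleftrightarrow>
      w k = - (w i + w j)" for i j k
  proof -
    have "complex_of_real c * w k = complex_of_real c * (- (w i + w j)) \<longleftrightarrow> w k = - (w i + w j)"
      using assms by (simp only: mult_cancel_left) simp
    then show ?thesis by (simp add: algebra_simps)
  qed
  moreover have "cmod (complex_of_real c * w i + complex_of_real c * w j) =
      (\<Sum>k=1..n. cmod (complex_of_real c * w k)) / (real n + 1) \<longleftrightarrow>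
      cmod (w i + w j) = (\<Sum>k=1..n. cmod (w k)) / (real n + 1)" for i j
  proof -
    have "cmod (complex_of_real c * w i + complex_of_real c * w j) = c * cmod (w i + w j)"
      using assms by (simp add: norm_mult flip: distrib_left)
    moreover have "(\<Sum>k=1..n. cmod (complex_of_real c * w k)) / (real n + 1) =
        c * ((\<Sum>k=1..n. cmod (w k)) / (real n + 1))"
      using assms by (simp add: norm_mult flip: sum_distrib_left)
    ultimately show ?thesis using assms by (simp only: mult_cancel_left) simp
  qed
  ultimately show ?thesis unfolding extremal_form_def by simp
qed

text \<open>
  Counting norms gives \<open>|w i| + |w j| = 3\<close>. For an index \<open>k\<close> other than \<open>i\<close> and \<open>j\<close> the vectors \<open>w k\<close>, \<open>w i\<close>, \<open>w j\<close>
  are the sides of a triangle of perimeter 4.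
\<close>

lemma pair_max_extremal_form:
  assumes "4 \<le> n" "extremal_form n w" "(\<Sum>k=1..n. cmod (w k)) = real n + 1"
  shows "pair_max n w = 4"
proof -
  from assms(2,3) obtain i j where ij: "i \<in> {1..n}" "j \<in> {1..n}" "i \<noteq> j"
    and eq: "\<And>k. k \<in> {1..n} - {i, j} \<Longrightarrow> w k = - (w i + w j)"
    and one: "cmod (w i + w j) = 1"
    unfolding extremal_form_def by auto
  define J where "J = {1..n} - {i, j}"
  have card: "card J = n - 2" using ij by (simp add: J_def card_Diff_subset)
  have norm: "cmod (w k) = 1" if "k \<in> J" for k
    using eq that one norm_minus_cancel[of "w i + w j"] by (simp add: J_def)
  have "(\<Sum>k=1..n. cmod (w k)) = cmod (w i) + cmod (w j) + (\<Sum>k\<in>J. cmod (w k))"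
    using sum.subset_diff[of "{i, j}" "{1..n}" "\<lambda>k. cmod (w k)"] ij by (simp add: J_def)
  also have "(\<Sum>k\<in>J. cmod (w k)) = real n - 2" using norm card assms(1) by simp
  finally have two: "cmod (w i) + cmod (w j) = 3" using assms(3) by simp
  have JJ: "perimeter (w k) (w l) = 4" if "k \<in> J" "l \<in> J" for k l
  proof -
    have "w k + w l = 2 * w k" using eq that by (simp add: J_def)
    then show ?thesis using norm that by (simp add: norm_mult)
  qed
  have Ji: "perimeter (w k) (w i) = 4" "perimeter (w k) (w j) = 4" if "k \<in> J" for k
  proof -
    have "w k + w i = - w j" "w k + w j = - w i" using eq that by (simp_all add: J_def)
    then show "perimeter (w k) (w i) = 4" "perimeter (w k) (w j) = 4"
      using norm[OF that] two by (simp_all only: norm_minus_cancel)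
  qed
  have all: "perimeter (w k) (w l) = 4" if "k \<in> {1..n}" "l \<in> {1..n}" "k \<noteq> l" for k l
  proof -
    have "perimeter (w i) (w j) = 4" using one two by simp
    moreover have "k \<in> J \<or> k = i \<or> k = j" "l \<in> J \<or> l = i \<or> l = j"
      using that by (auto simp: J_def)
    ultimately show ?thesis using that JJ Ji by (metis perimeter_commute)
  qed
  then have "pair_max n w \<le> M \<longleftrightarrow> 4 \<le> M" for M
  proof -
    have "(1::nat) \<in> {1..n}" "2 \<in> {1..n}" "(1::nat) \<noteq> 2" using assms(1) by auto
    then show ?thesis using all assms(1) by (subst pair_max_le_iff) (simp, metis)
  qed
  then show ?thesis by (meson antisym order_refl)
qed

lemma pair_max_normalised:
  assumes "4 \<le> n" and total: "(\<Sum>k=1..n. cmod (w k)) = real n + 1"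
  shows "4 \<le> pair_max n w" and "pair_max n w = 4 \<longleftrightarrow> extremal_form n w"
proof -
  have form: "extremal_form n w" if le: "pair_max n w \<le> 4"
  proof -
    have "perimeter (w k) (w l) \<le> 4" if "k \<in> {1..n}" "l \<in> {1..n}" "k \<noteq> l" for k l
      using le that assms(1) by (simp add: pair_max_le_iff)
    moreover have "1 \<le> (\<Sum>k=1..n. cmod (w k) - 1)" using total by (simp add: sum_subtractf)
    ultimately obtain i j where "i \<in> {1..n}" "j \<in> {1..n}" "i \<noteq> j" "cmod (w i + w j) = 1"
      "\<And>k. k \<in> {1..n} - {i, j} \<Longrightarrow> w k = - (w i + w j)"
      using extremal_structure[of "{1..n}" w] assms(1)
      by (metis card_atLeastAtMost diff_Suc_1 finite_atLeastAtMost One_nat_def)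
    then show ?thesis unfolding extremal_form_def total
      by (intro bexI[of _ i] bexI[of _ j] conjI ballI) simp_all
  qed
  note attained = pair_max_extremal_form[OF assms(1) _ total]
  show "4 \<le> pair_max n w" using form attained by force
  show "pair_max n w = 4 \<longleftrightarrow> extremal_form n w" using form attained by auto
qed

lemma pair_max_sharp:
  assumes "4 \<le> n" and pos: "0 < (\<Sum>k=1..n. cmod (w k))"
  defines "R \<equiv> (\<Sum>k=1..n. cmod (w k))"
  shows "4 / (real n + 1) * R \<le> pair_max n w"
    and "pair_max n w = 4 / (real n + 1) * R \<longleftrightarrow> extremal_form n w"
proof -
  define c where "c = (real n + 1) / R"
  define v where "v = (\<lambda>k. complex_of_real c * w k)"
  have R: "R > 0" and c: "c > 0" using pos by (auto simp: R_def c_def)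
  have "(\<Sum>k=1..n. cmod (v k)) = c * R"
    using c by (simp add: v_def R_def norm_mult flip: sum_distrib_left)
  also have "\<dots> = real n + 1" using R by (simp add: c_def)
  finally have "(\<Sum>k=1..n. cmod (v k)) = real n + 1" .
  note v = pair_max_normalised[OF assms(1) this]
  have "pair_max n v = c * pair_max n w"
    unfolding v_def using assms(1) c by (intro pair_max_scale) auto
  moreover have "extremal_form n v \<longleftrightarrow> extremal_form n w"
    unfolding v_def using c by (rule extremal_form_scale)
  moreover have four: "4 / (real n + 1) * R = 4 / c" by (simp add: c_def)
  ultimately show "4 / (real n + 1) * R \<le> pair_max n w"
    and "pair_max n w = 4 / (real n + 1) * R \<longleftrightarrow> extremal_form n w"
    using v c unfolding four by (auto simp: field_simps)
qed

lemma mu_max_value: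
  assumes "4 \<le> n"
  shows "mu_max n = 4 / (real n + 1)"
  unfolding mu_max_def
proof (rule cInf_eq_minimum)
  \<comment> \<open>The extremal form with exceptional values \<open>1\<close> and \<open>- 2\<close>, so that all vectors but the last are equal.\<close>
  define w :: "nat \<Rightarrow> complex" where "w = (\<lambda>k. if k = n then - 2 else 1)"
  define v where "v = (\<lambda>k. complex_of_real (1 / (real n + 1)) * w k)"
  have "(\<Sum>k=1..n. cmod (w k)) = cmod (w n) + (\<Sum>k\<in>{1..n} - {n}. cmod (w k))"
    using assms by (subst sum.remove[of _ n]) auto
  also have "\<dots> = real n + 1" using assms by (simp add: w_def)
  finally have total: "(\<Sum>k=1..n. cmod (w k)) = real n + 1" .
  have "extremal_form n w"
    unfolding extremal_form_def total using assms
    by (intro bexI[of _ n] bexI[of _ 1]) (auto simp: w_def)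
  then have "extremal_form n v" unfolding v_def using assms by (subst extremal_form_scale) auto
  moreover have "(\<Sum>k=1..n. cmod (v k)) = 1"
  proof -
    have "(\<Sum>k=1..n. cmod (v k)) = (\<Sum>k=1..n. cmod (w k)) / (real n + 1)"
      unfolding v_def norm_mult norm_of_real by (simp add: sum_divide_distrib)
    then show ?thesis using total by simp
  qed
  ultimately show "4 / (real n + 1) \<in> {pair_max n w |w. (\<Sum>k=1..n. cmod (w k)) = 1}"
    using pair_max_sharp(2)[OF assms, of v] by force
next
  fix x assume "x \<in> {pair_max n w |w. (\<Sum>k=1..n. cmod (w k)) = 1}"
  then obtain w where "x = pair_max n w" "(\<Sum>k=1..n. cmod (w k)) = 1" by blast
  then show "4 / (real n + 1) \<le> x" using pair_max_sharp(1)[OF assms, of w] by simp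
qed

lemma optimal_iff_extremal_form:
  assumes "4 \<le> n" and pos: "0 < (\<Sum>k=1..n. cmod (z k))"
  shows "optimal n z \<longleftrightarrow> extremal_form n z"
proof -
  define R where "R = (\<Sum>k=1..n. cmod (z k))"
  have scale: "(\<Sum>k=1..n. cmod (complex_of_real c * z k)) = c * R" if "c > 0" for c
    using that by (simp add: R_def norm_mult flip: sum_distrib_left)
  have iff: "pair_max n (\<lambda>k. complex_of_real c * z k) = mu_max n \<longleftrightarrow> extremal_form n z"
    if "c > 0" "c * R = 1" for c
    using pair_max_sharp(2)[OF assms(1), of "\<lambda>k. complex_of_real c * z k"]
    unfolding scale[OF that(1)] mu_max_value[OF assms(1)] extremal_form_scale[OF that(1)] that(2)
    by simp
  have "1 / R > 0" "1 / R * R = 1" using pos by (auto simp: R_def)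
  then show ?thesis unfolding optimal_def using scale iff by metis
qed

section \<open>Permuting the exceptional indices to the end\<close>
lemma exists_permutation_to_end:
  fixes n :: nat
  assumes "2 \<le> n" "i \<in> {1..n}" "j \<in> {1..n}" "i \<noteq> j"
  obtains p where "p permutes {1..n}" "p (n - 1) = i" "p n = j"
proof
  \<comment> \<open>The second swap refers to \<open>t j\<close> because the first one may have moved \<open>j\<close>.\<close>
  define t where "t = transpose i (n - 1)"
  have t: "t permutes {1..n}" unfolding t_def using assms by (intro permutes_swap_id) auto
  then have tj: "t j \<in> {1..n}" using assms(3) by (simp only: permutes_in_image)
  have "t (n - 1) = i" by (simp add: t_def)
  moreover have "t (t j) = j" by (simp add: t_def)
  moreover have "t j \<noteq> n - 1" using calculation assms(4) by auto
  ultimately show "(t \<circ> transpose n (t j)) (n - 1) = i" "(t \<circ> transpose n (t j)) n = j"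
    using assms(1) by (auto simp: transpose_apply_other)
  show "(t \<circ> transpose n (t j)) permutes {1..n}"
    using assms(1) tj t by (intro permutes_compose permutes_swap_id) auto
qed

lemma extremal_form_iff_permutation:
  assumes "4 \<le> n"
  shows "extremal_form n z \<longleftrightarrow>
    (\<exists>p. p permutes {1..n} \<and>
       (\<forall>k\<in>{1..n-2}. z (p k) = z (p 1)) \<and>
       cmod (z (p 1)) = 1 / (real n + 1) * (\<Sum>k=1..n. cmod (z k)) \<and>
       z (p 1) + z (p (n-1)) + z (p n) = 0)" (is "_ \<longleftrightarrow> (\<exists>p. ?P p)")
proof
  assume "extremal_form n z"
  then obtain i j where ij: "i \<in> {1..n}" "j \<in> {1..n}" "i \<noteq> j"
    and eq: "\<And>k. k \<in> {1..n} - {i, j} \<Longrightarrow> z k = - (z i + z j)"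
    and norm: "cmod (z i + z j) = (\<Sum>k=1..n. cmod (z k)) / (real n + 1)"
    unfolding extremal_form_def by auto
  obtain p where p: "p permutes {1..n}" "p (n - 1) = i" "p n = j"
    using exists_permutation_to_end[OF _ ij] assms by auto
  have z: "z (p k) = - (z i + z j)" if k: "k \<in> {1..n-2}" for k
  proof -
    have "p k \<noteq> p (n - 1)" "p k \<noteq> p n"
      using k assms by (auto simp: inj_eq[OF permutes_inj[OF p(1)]])
    moreover have "p k \<in> {1..n}" using k by (subst permutes_in_image[OF p(1)]) auto
    ultimately show ?thesis using p by (intro eq) auto
  qed
  have "1 \<in> {1..n-2}" using assms by auto
  note z1 = z[OF this]
  have "cmod (z (p 1)) = cmod (z i + z j)" unfolding z1 by (rule norm_minus_cancel)
  then have "?P p" using p z z1 norm by simp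
  then show "\<exists>p. ?P p" by (intro exI[of _ p])
next
  assume "\<exists>p. ?P p"
  then obtain p where p: "p permutes {1..n}" and P: "?P p" by blast
  have z1: "z (p 1) = - (z (p (n - 1)) + z (p n))" using P by (simp only: eq_neg_iff_add_eq_0 add.assoc)
  have "z k = - (z (p (n - 1)) + z (p n))" if k: "k \<in> {1..n} - {p (n - 1), p n}" for k
  proof -
    have "k \<in> p ` {1..n}" using k permutes_image[OF p] by auto
    then obtain l where l: "l \<in> {1..n}" "k = p l" by auto
    then have "l \<noteq> n - 1" "l \<noteq> n" using k by auto
    then have "l \<in> {1..n-2}" using l by auto
    then show ?thesis using P l z1 by metis
  qed
  moreover have "p (n - 1) \<in> {1..n}" "p n \<in> {1..n}" "p (n - 1) \<noteq> p n"
    unfolding permutes_in_image[OF p] inj_eq[OF permutes_inj[OF p]] using assms by auto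
  moreover have "cmod (z (p (n - 1)) + z (p n)) = (\<Sum>k=1..n. cmod (z k)) / (real n + 1)"
  proof -
    have "cmod (z (p 1)) = cmod (z (p (n - 1)) + z (p n))" unfolding z1 by (rule norm_minus_cancel)
    then show ?thesis using P by simp
  qed
  ultimately show "extremal_form n z" unfolding extremal_form_def by blast
qed

theorem theorem3p12:
  fixes n :: nat and z :: "nat \<Rightarrow> complex"
  assumes "n \<ge> 4"
    and "\<exists>k\<in>{1..n}. z k \<noteq> 0"
  shows "optimal n z \<longleftrightarrow>
    (\<exists>p. p permutes {1..n} \<and>
       (\<forall>k\<in>{1..n-2}. z (p k) = z (p 1)) \<and>
       cmod (z (p 1)) = 1 / (real n + 1) * (\<Sum>k=1..n. cmod (z k)) \<and>
       z (p 1) + z (p (n-1)) + z (p n) = 0)"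
proof -
  have "0 < (\<Sum>k=1..n. cmod (z k))"
    using assms(2) by (metis finite_atLeastAtMost norm_ge_zero sum_pos2 zero_less_norm_iff)
  then show ?thesis
    using assms(1) by (simp only: optimal_iff_extremal_form extremal_form_iff_permutation)
qed

end
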